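(* Let $F$ be a free group. Then the primitive width of $F$ is infinite if and only if $F$ is finitely generated. The primitive width of any infinitely generated free group is two.
   Context: Width: if $G$ is a group generated by a subset $S$, then for $g\in G$ the length $l_S(g)$ is the minimal $k$ such that $g$ is a product of $k$ elements of $S$; the width $\mathrm{wid}(G,S)$ is the supremum of $l_S(g)$ over $g\in G$ (a natural number or $\infty$). An element of a free group $F$ is primitive if it belongs to some basis (free generating set) of $F$. The primitive width of $F$ is the width of $F$ with respect to the set of all primitive elements of $F$.
   Formalization: The free group F is assumed nontrivial: the trivial group is free and finitely generated, but it has no primitive elements and its primitive width is 0, so the claim fails for it. *)

theory Defs
  imports "HOL-Algebra.Generated_Groups" "HOL-Library.Extended_Nat"
begin

text \<open>
  The word \<open>[g\<^sub>1, \<dots>, g\<^sub>k]\<close> has value \<open>g\<^sub>1 \<cdots> g\<^sub>k\<close>; the empty word has value \<open>\<one>\<close>.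
\<close>

definition word_prod :: "('a, 'b) monoid_scheme \<Rightarrow> 'a list \<Rightarrow> 'a" where
  "word_prod G gs = foldr (mult G) gs \<one>\<^bsub>G\<^esub>"

text \<open>
  Length and width take values in \<open>\<nat> \<union> {\<infinity>}\<close>. Since \<open>Inf {} = \<infinity>\<close> in \<^typ>\<open>enat\<close>, an element
  that is not a product of elements of \<open>S\<close> has infinite length. Inverses of elements of \<open>S\<close>
  are not allowed as factors unless they belong to \<open>S\<close> themselves.
\<close>

definition len :: "('a, 'b) monoid_scheme \<Rightarrow> 'a set \<Rightarrow> 'a \<Rightarrow> enat" where
  "len G S g = (INF gs \<in> {gs. set gs \<subseteq> S \<and> word_prod G gs = g}. enat (length gs))"

definition width :: "('a, 'b) monoid_scheme \<Rightarrow> 'a set \<Rightarrow> enat" where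
  "width G S = (SUP g \<in> carrier G. len G S g)"

text \<open>
  A group word over \<open>B\<close> is a list of letters \<open>(x, e)\<close> with \<open>x \<in> B\<close>, where \<open>(x, True)\<close> stands
  for \<open>x\<close> and \<open>(x, False)\<close> for the inverse of \<open>x\<close>. It is reduced if no two adjacent letters are
  formally inverse to each other.
\<close>

definition reduced :: "('a \<times> bool) list \<Rightarrow> bool" where
  "reduced w \<longleftrightarrow> successively (\<lambda>(x, e) (y, f). x = y \<longrightarrow> e = f) w"

definition letter :: "('a, 'b) monoid_scheme \<Rightarrow> 'a \<times> bool \<Rightarrow> 'a" where
  "letter G = (\<lambda>(x, e). if e then x else inv\<^bsub>G\<^esub> x)"

text \<open>
  A basis is a generating set in which no nonempty reduced word represents \<open>\<one>\<close>. HOL cannot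
  quantify over the types of all target groups, so the definition by words is used rather than
  the universal property.
\<close>

definition free_basis :: "('a, 'b) monoid_scheme \<Rightarrow> 'a set \<Rightarrow> bool" where
  "free_basis G B \<longleftrightarrow>
     B \<subseteq> carrier G \<and> generate G B = carrier G \<and>
     (\<forall>w. w \<noteq> [] \<and> fst ` set w \<subseteq> B \<and> reduced w \<longrightarrow> word_prod G (map (letter G) w) \<noteq> \<one>\<^bsub>G\<^esub>)"

definition free_group :: "('a, 'b) monoid_scheme \<Rightarrow> bool" where
  "free_group G \<longleftrightarrow> group G \<and> (\<exists>B. free_basis G B)"

definition finitely_generated :: "('a, 'b) monoid_scheme \<Rightarrow> bool" where
  "finitely_generated G \<longleftrightarrow> (\<exists>S. finite S \<and> S \<subseteq> carrier G \<and> generate G S = carrier G)"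

definition primitive :: "('a, 'b) monoid_scheme \<Rightarrow> 'a \<Rightarrow> bool" where
  "primitive G g \<longleftrightarrow> (\<exists>B. free_basis G B \<and> g \<in> B)"

definition primitive_width :: "('a, 'b) monoid_scheme \<Rightarrow> enat" where
  "primitive_width G = width G {g. primitive G g}"

end

theory Submission
  imports Defs "HOL-Algebra.Elementary_Groups" "HOL-Library.Sublist"
begin

text \<open>
  In infinite rank, every \<open>g\<close> equals \<open>(g x) x\<^sup>-\<^sup>1\<close> for a basis element \<open>x\<close> that does not occur in \<open>g\<close>,
  and both factors are primitive; a square \<open>x\<^sup>2\<close> is not primitive, as the homomorphism to \<open>\<int>\<close>
  that sends a basis through it to \<open>1\<close> would have an even value there.

  In finite rank at least two, let \<open>v\<close> be a positive word that contains all products of two basis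
  elements. The Brooks counting quasimorphism of \<open>v\<close> is unbounded but bounded above on primitive
  elements, because \<open>v\<close> is not a subword of a cyclically reduced primitive word \<open>w\<close>. The latter
  is Whitehead's cut vertex lemma. A basis through \<open>w\<close> yields a set \<open>Y\<close> with \<open>Y w = Y\<close> that is
  infinite, co-infinite and changed only finitely by right multiplications, i.e. a clopen
  partition of the boundary that separates the ends of no translate of the axis of \<open>w\<close>; at a
  suitable vertex of the Cayley tree, such a partition disconnects the Whitehead graph of \<open>w\<close> minus
  at most one point.
\<close>

section \<open>Reduced words\<close>

definition linv :: "'a \<times> bool \<Rightarrow> 'a \<times> bool" where
  "linv l = (fst l, \<not> snd l)"

definition winv :: "('a \<times> bool) list \<Rightarrow> ('a \<times> bool) list" where
  "winv w = rev (map linv w)"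

lemma linv_linv [simp]: "linv (linv l) = l"
  by (simp add: linv_def)

lemma fst_linv [simp]: "fst (linv l) = fst l"
  by (simp add: linv_def)

lemma snd_linv [simp]: "snd (linv l) \<longleftrightarrow> \<not> snd l"
  by (simp add: linv_def)

lemma linv_neq [simp]: "linv l \<noteq> l" "l \<noteq> linv l"
  by (auto simp: linv_def prod_eq_iff)

lemma winv_simps [simp]:
  "winv [] = []" "winv (l # w) = winv w @ [linv l]" "winv (u @ w) = winv w @ winv u"
  by (simp_all add: winv_def)

lemma winv_winv [simp]: "winv (winv w) = w"
  by (simp add: winv_def rev_map comp_def)

lemma winv_eq_Nil [simp]: "winv w = [] \<longleftrightarrow> w = []"
  by (simp add: winv_def)

lemma fst_set_winv [simp]: "fst ` set (winv w) = fst ` set w"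
  by (simp add: winv_def image_image)

lemma reduced_alt: "reduced w \<longleftrightarrow> successively (\<lambda>l m. m \<noteq> linv l) w"
  unfolding reduced_def
  by (rule successively_cong) (auto simp: linv_def)

lemma reduced_Nil [simp]: "reduced []"
  by (simp add: reduced_alt)

lemma reduced_Cons: "reduced (l # w) \<longleftrightarrow> w = [] \<or> hd w \<noteq> linv l \<and> reduced w"
  by (auto simp: reduced_alt successively_Cons)

lemma reduced_append:
  "reduced (u @ w) \<longleftrightarrow> reduced u \<and> reduced w \<and> (u = [] \<or> w = [] \<or> hd w \<noteq> linv (last u))"
  by (auto simp: reduced_alt successively_append_iff)

lemma reduced_winv [simp]: "reduced (winv w) \<longleftrightarrow> reduced w"
proof -
  show ?thesis
    unfolding reduced_alt winv_def by (simp only: successively_rev successively_map)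
       (auto intro!: successively_cong simp: eq_commute)
qed

text \<open>\<open>c\<close> is the part that cancels at the junction; it is peeled off the end of
  \<open>u\<close> one letter at a time.\<close>

lemma reduced_cancel:
  assumes "reduced u" "reduced w"
  obtains a b c where "u = a @ c" "w = winv c @ b" "reduced (a @ b)"
proof -
  have "\<exists>a b c. u = a @ c \<and> w = winv c @ b \<and> reduced (a @ b)"
    using assms
  proof (induction u arbitrary: w rule: rev_induct)
    case Nil
    then show ?case by (intro exI[of _ "[]"] exI[of _ w]) auto
  next
    case (snoc l u)
    show ?case
    proof (cases "\<exists>w'. w = linv l # w'")
      case True
      then obtain w' where w: "w = linv l # w'" by blast
      have "reduced u" "reduced w'"
        using snoc.prems by (auto simp: w reduced_append reduced_Cons)
      from snoc.IH[OF this] obtain a b c where "u = a @ c" "w' = winv c @ b" "reduced (a @ b)"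
        by blast
      then show ?thesis
        by (intro exI[of _ a] exI[of _ b] exI[of _ "c @ [l]"]) (simp add: w)
    next
      case False
      then have "w = [] \<or> hd w \<noteq> linv l"
        by (cases w) auto
      then have "reduced ((u @ [l]) @ w)"
        using snoc.prems by (subst reduced_append) auto
      then show ?thesis
        by (intro exI[of _ "u @ [l]"] exI[of _ w] exI[of _ "[]"]) simp
    qed
  qed
  then show thesis using that by blast
qed

text \<open>Strip the first and last letters as long as they are inverse to each other. For nonempty
  \<open>w\<close>, reducedness of \<open>w @ w\<close> expresses that \<open>w\<close> is
  cyclically reduced.\<close>

lemma reduced_cyclic_decomp:
  assumes "reduced u" "u \<noteq> []"
  obtains t w where "u = t @ w @ winv t" "w \<noteq> []" "reduced (w @ w)"
proof -
  have "\<exists>t w. u = t @ w @ winv t \<and> w \<noteq> [] \<and> reduced (w @ w)"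
    using assms
  proof (induction "length u" arbitrary: u rule: less_induct)
    case less
    show ?case
    proof (cases "hd u = linv (last u)")
      case False
      then have "reduced (u @ u)"
        using less.prems by (auto simp: reduced_append)
      then show ?thesis
        using less.prems by (intro exI[of _ "[]"] exI[of _ u]) simp
    next
      case True
      obtain l u1 where u1: "u = l # u1"
        using less.prems by (cases u) auto
      have "u1 \<noteq> []"
        using True u1 by auto
      then obtain u2 m where u2: "u1 = u2 @ [m]"
        by (metis rev_exhaust)
      have m: "m = linv l"
        using True u1 u2 by simp
      \<comment> \<open>Otherwise \<open>u\<close> would be \<open>[l, linv l]\<close>, which is not
        reduced.\<close>
      have "u2 \<noteq> []" "reduced u2"
        using less.prems u1 u2 m by (auto simp: reduced_append reduced_Cons)
      moreover have "length u2 < length u"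
        using u1 u2 by simp
      ultimately obtain t w where "u2 = t @ w @ winv t" "w \<noteq> []" "reduced (w @ w)"
        using less.hyps by blast
      then show ?thesis
        using u1 u2 m by (intro exI[of _ "l # t"] exI[of _ w]) simp
    qed
  qed
  then show thesis using that by blast
qed

lemma reduced_power:
  assumes "reduced (w @ w)"
  shows "reduced (concat (replicate k w))"
proof (cases "w = []")
  case True
  then show ?thesis by (induction k) auto
next
  case False
  show ?thesis
  proof (induction k)
    case (Suc k)
    have "concat (replicate k w) = [] \<or> hd (concat (replicate k w)) = hd w"
      using False by (cases k) auto
    then show ?case
      using Suc assms False by (auto simp: reduced_append)
  qed simp
qed

lemma reduced_if_all_positive:
  assumes "\<And>l. l \<in> set w \<Longrightarrow> snd l"
  shows "reduced w"
  using assms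
proof (induction w)
  case (Cons l w)
  then have "reduced w" "snd l" "w \<noteq> [] \<Longrightarrow> snd (hd w)"
    by auto
  then show ?case
    by (auto simp: reduced_Cons)
qed simp


section \<open>Evaluation of words\<close>

definition eval :: "('a, 'b) monoid_scheme \<Rightarrow> ('a \<times> bool) list \<Rightarrow> 'a" where
  "eval G w = word_prod G (map (letter G) w)"

context group
begin

lemma word_prod_closed: "set gs \<subseteq> carrier G \<Longrightarrow> word_prod G gs \<in> carrier G"
  by (induction gs) (auto simp: word_prod_def)

lemma letter_closed: "fst l \<in> carrier G \<Longrightarrow> letter G l \<in> carrier G"
  by (cases l) (auto simp: letter_def)

lemma letter_linv: "fst l \<in> carrier G \<Longrightarrow> letter G (linv l) = inv letter G l"
  by (cases l) (auto simp: letter_def linv_def)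

lemma eval_Nil [simp]: "eval G [] = \<one>"
  by (simp add: eval_def word_prod_def)

lemma eval_Cons: "eval G (l # w) = letter G l \<otimes> eval G w"
  by (simp add: eval_def word_prod_def)

lemma eval_closed: "fst ` set w \<subseteq> carrier G \<Longrightarrow> eval G w \<in> carrier G"
  by (induction w) (auto simp: eval_Cons letter_closed)

lemma eval_append:
  "fst ` set u \<subseteq> carrier G \<Longrightarrow> fst ` set w \<subseteq> carrier G \<Longrightarrow> eval G (u @ w) = eval G u \<otimes> eval G w"
  by (induction u) (auto simp: eval_Cons letter_closed eval_closed m_assoc)

lemma eval_winv: "fst ` set w \<subseteq> carrier G \<Longrightarrow> eval G (winv w) = inv eval G w"
  by (induction w)
     (auto simp: eval_Cons letter_closed eval_closed eval_append letter_linv inv_mult_group)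

text \<open>Reduction only deletes letters; this control of the letters is what
  \<open>finite_basis\<close> relies on.\<close>

lemma eval_reduce:
  assumes "fst ` set w \<subseteq> carrier G"
  obtains u where "reduced u" "fst ` set u \<subseteq> fst ` set w" "eval G u = eval G w"
proof -
  have "\<exists>u. reduced u \<and> fst ` set u \<subseteq> fst ` set w \<and> eval G u = eval G w"
    using assms
  proof (induction w)
    case (Cons l w)
    then obtain u where u: "reduced u" "fst ` set u \<subseteq> fst ` set w" "eval G u = eval G w"
      by auto
    show ?case
    proof (cases "\<exists>u'. u = linv l # u'")
      case True
      then obtain u' where u': "u = linv l # u'" by blast
      have "fst l \<in> carrier G" "eval G u' \<in> carrier G"
        using u u' Cons.prems by (auto intro!: eval_closed)
      then have "eval G (l # w) = eval G u'"
        by (simp add: eval_Cons u' letter_linv letter_closed m_assoc[symmetric] u(3)[symmetric])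
      then show ?thesis
        using u u' by (intro exI[of _ u']) (auto simp: reduced_Cons)
    next
      case False
      then show ?thesis
        using u by (intro exI[of _ "l # u"]) (cases u; auto simp: reduced_Cons eval_Cons)
    qed
  qed (auto intro: exI[of _ "[]"])
  then show thesis using that by blast
qed

lemma eval_in_generate: "fst ` set w \<subseteq> X \<Longrightarrow> eval G w \<in> generate G X"
proof (induction w)
  case (Cons l w)
  have "letter G l \<in> generate G X"
    using Cons.prems by (cases l) (auto simp: letter_def intro: generate.incl generate.inv)
  then show ?case
    using Cons by (auto simp: eval_Cons intro: generate.eng)
qed (simp add: generate.one)

lemma generate_obtain_word:
  assumes "g \<in> generate G X" "X \<subseteq> carrier G"
  obtains w where "fst ` set w \<subseteq> X" "eval G w = g"
proof -
  have "\<exists>w. fst ` set w \<subseteq> X \<and> eval G w = g"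
    using assms(1)
  proof (induction rule: generate.induct)
    case one
    show ?case by (intro exI[of _ "[]"]) simp
  next
    case (incl h)
    then show ?case
      using assms(2) by (intro exI[of _ "[(h, True)]"]) (auto simp: eval_Cons letter_def)
  next
    case (inv h)
    then show ?case
      using assms(2) by (intro exI[of _ "[(h, False)]"]) (auto simp: eval_Cons letter_def)
  next
    case (eng g h)
    then obtain u w where "fst ` set u \<subseteq> X" "eval G u = g" "fst ` set w \<subseteq> X" "eval G w = h"
      by blast
    moreover from this have "eval G (u @ w) = g \<otimes> h"
      using assms(2) by (subst eval_append) auto
    ultimately show ?case
      by (intro exI[of _ "u @ w"]) (simp add: image_Un)
  qed
  then show thesis using that by blast
qed

end

lemma eval_hom:
  assumes "group G" "group H" "h \<in> hom G H" "fst ` set w \<subseteq> carrier G"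
  shows "h (eval G w) = eval H (map (apfst h) w)"
proof -
  interpret group_hom G H h
    using assms by (simp add: group_hom_def group_hom_axioms_def)
  show ?thesis
    using assms(4)
  proof (induction w)
    case (Cons l w)
    have "h (letter G l) = letter H (apfst h l)"
      using Cons.prems by (cases l) (auto simp: letter_def)
    then show ?case
      using Cons by (simp add: G.eval_Cons H.eval_Cons G.letter_closed G.eval_closed)
  qed simp
qed


section \<open>Normal forms\<close>

text \<open>The basis is a parameter because two bases of one group are compared later: the fixed
  one and one through a given primitive element.\<close>

locale free_on = group G for G (structure) +
  fixes X
  assumes basis: "free_basis G X"
begin

lemma X_subset: "X \<subseteq> carrier G"
  using basis by (simp add: free_basis_def)

lemma word_over_carrier: "fst ` set w \<subseteq> X \<Longrightarrow> fst ` set w \<subseteq> carrier G"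
  using X_subset by blast

lemma eval_carrier [simp]: "fst ` set w \<subseteq> X \<Longrightarrow> eval G w \<in> carrier G"
  by (intro eval_closed word_over_carrier)

lemma eval_app: "fst ` set u \<subseteq> X \<Longrightarrow> fst ` set w \<subseteq> X \<Longrightarrow> eval G (u @ w) = eval G u \<otimes> eval G w"
  by (intro eval_append word_over_carrier)

lemma eval_inv: "fst ` set w \<subseteq> X \<Longrightarrow> eval G (winv w) = inv eval G w"
  by (intro eval_winv word_over_carrier)

lemma eval_neq_one: "w \<noteq> [] \<Longrightarrow> fst ` set w \<subseteq> X \<Longrightarrow> reduced w \<Longrightarrow> eval G w \<noteq> \<one>"
  using basis by (simp add: free_basis_def eval_def)

lemma eval_inj:
  assumes "reduced u" "fst ` set u \<subseteq> X" "reduced w" "fst ` set w \<subseteq> X" "eval G u = eval G w"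
  shows "u = w"
  using assms
proof (induction u arbitrary: w)
  case Nil
  then show ?case using eval_neq_one[of w] by auto
next
  case (Cons l u)
  show ?case
  proof (cases w)
    case Nil
    then show ?thesis using Cons.prems eval_neq_one[of "l # u"] by auto
  next
    case w: (Cons m w')
    have lc: "letter G l \<in> carrier G"
      using Cons.prems X_subset by (auto intro: letter_closed)
    show ?thesis
    proof (cases "l = m")
      case True
      have "eval G u = eval G w'"
        using Cons.prems lc by (simp add: w True eval_Cons)
      then show ?thesis
        using Cons.IH[of w'] Cons.prems by (auto simp: w True reduced_Cons)
    next
      case False
      \<comment> \<open>Distinct first letters prevent cancellation at the junction, so a nonempty
        reduced word would have value \<open>\<one>\<close>.\<close>
      have "reduced (winv (l # u) @ w)"
        using Cons.prems False
        by (subst reduced_append) (simp add: w reduced_append del: winv_simps, simp)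
      moreover have "eval G (winv (l # u) @ w) = \<one>"
        using Cons.prems by (subst eval_app) (simp_all add: eval_inv l_inv del: winv_simps set_simps)
      moreover have "fst ` set (winv (l # u) @ w) \<subseteq> X"
        using Cons.prems by (simp add: image_Un del: winv_simps)
      ultimately show ?thesis
        using eval_neq_one[of "winv (l # u) @ w"] by (simp add: w)
    qed
  qed
qed

definition nf :: "'a \<Rightarrow> ('a \<times> bool) list" where
  "nf g = (THE w. reduced w \<and> fst ` set w \<subseteq> X \<and> eval G w = g)"

lemma nf_eqI: "reduced w \<Longrightarrow> fst ` set w \<subseteq> X \<Longrightarrow> eval G w = g \<Longrightarrow> nf g = w"
  unfolding nf_def by (rule the_equality) (auto intro: eval_inj)

lemma nf_eval: "reduced w \<Longrightarrow> fst ` set w \<subseteq> X \<Longrightarrow> nf (eval G w) = w"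
  by (rule nf_eqI) auto

lemma nf:
  assumes "g \<in> carrier G"
  shows nf_reduced: "reduced (nf g)" and nf_letters: "fst ` set (nf g) \<subseteq> X"
    and eval_nf: "eval G (nf g) = g"
proof -
  have "g \<in> generate G X"
    using assms basis by (simp add: free_basis_def)
  then obtain w where w: "fst ` set w \<subseteq> X" "eval G w = g"
    using generate_obtain_word X_subset by metis
  then obtain u where "reduced u" "fst ` set u \<subseteq> X" "eval G u = g"
    using eval_reduce[of w] X_subset by (metis order_trans)
  moreover from this have "nf g = u"
    by (rule nf_eqI)
  ultimately show "reduced (nf g)" "fst ` set (nf g) \<subseteq> X" "eval G (nf g) = g"
    by auto
qed

lemma nf_one [simp]: "nf \<one> = []"
  by (rule nf_eqI) auto

lemma nf_eq_Nil: "g \<in> carrier G \<Longrightarrow> nf g = [] \<longleftrightarrow> g = \<one>"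
  using eval_nf by force

lemma nf_basis: "x \<in> X \<Longrightarrow> nf x = [(x, True)]"
  using X_subset by (intro nf_eqI) (auto simp: eval_Cons letter_def reduced_Cons)

lemma nf_mult:
  assumes "g \<in> carrier G" "h \<in> carrier G"
  obtains a b c where "nf g = a @ c" "nf h = winv c @ b" "nf (g \<otimes> h) = a @ b"
    "fst ` set a \<subseteq> X" "fst ` set b \<subseteq> X" "fst ` set c \<subseteq> X"
proof -
  obtain a b c where *: "nf g = a @ c" "nf h = winv c @ b" "reduced (a @ b)"
    using reduced_cancel nf_reduced assms by metis
  have X: "fst ` set a \<subseteq> X" "fst ` set c \<subseteq> X" "fst ` set b \<subseteq> X"
    using nf_letters[OF assms(1)] nf_letters[OF assms(2)] * by (auto simp: image_Un)
  have "g = eval G a \<otimes> eval G c" "h = inv (eval G c) \<otimes> eval G b"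
    using eval_nf[OF assms(1)] eval_nf[OF assms(2)] * X by (auto simp: eval_app eval_inv)
  then have "g \<otimes> h = eval G a \<otimes> ((eval G c \<otimes> inv (eval G c)) \<otimes> eval G b)"
    using X by (simp add: m_assoc r_inv flip: m_assoc[of "eval G c"])
  then have "nf (g \<otimes> h) = a @ b"
    using X * by (intro nf_eqI) (auto simp: eval_app image_Un)
  from that[OF *(1,2) this X(1,3,2)] show thesis .
qed

text \<open>Right multiplication by a letter is a step along an edge of the Cayley tree, either away
  from \<open>\<one>\<close> or towards it.\<close>

lemma nf_snoc:
  assumes "h \<in> carrier G" "fst l \<in> X"
  shows "nf (h \<otimes> letter G l) = nf h @ [l] \<or> nf h = nf (h \<otimes> letter G l) @ [linv l]"
proof -
  have l: "letter G l \<in> carrier G" "nf (letter G l) = [l]"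
    using assms X_subset by (auto intro!: letter_closed nf_eqI r_one simp: reduced_Cons eval_Cons)
  then obtain a b c where "nf h = a @ c" "[l] = winv c @ b" "nf (h \<otimes> letter G l) = a @ b"
    using nf_mult[OF assms(1) l(1)] by metis
  then show ?thesis
    by (cases "c = []") (auto simp: append_eq_Cons_conv Cons_eq_append_conv winv_def)
qed

section \<open>The universal property of a basis\<close>

definition ext :: "('c, 'd) monoid_scheme \<Rightarrow> ('a \<Rightarrow> 'c) \<Rightarrow> 'a \<Rightarrow> 'c" where
  "ext H f g = eval H (map (apfst f) (nf g))"

text \<open>By \<open>nf_mult\<close>, the normal forms of \<open>g\<close> and \<open>h\<close>
  differ from that of the product only by a cancelling pair \<open>c\<close>, \<open>winv c\<close>,
  whose images cancel in \<open>H\<close> as well.\<close>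

lemma ext_hom:
  assumes "group H" "f ` X \<subseteq> carrier H"
  shows "ext H f \<in> hom G H"
proof (rule homI)
  interpret H: group H by fact
  have cl: "fst ` set (map (apfst f) w) \<subseteq> carrier H" if "fst ` set w \<subseteq> X" for w :: "('a \<times> bool) list"
    using assms(2) that by (force simp: image_subset_iff)
  have winv_map: "map (apfst f) (winv w) = winv (map (apfst f) w)" for w :: "('a \<times> bool) list"
    by (auto simp: winv_def rev_map linv_def)
  show "ext H f g \<in> carrier H" if "g \<in> carrier G" for g
    unfolding ext_def by (intro H.eval_closed cl nf_letters that)
  show "ext H f (g \<otimes> h) = ext H f g \<otimes>\<^bsub>H\<^esub> ext H f h" if gh: "g \<in> carrier G" "h \<in> carrier G" for g h
  proof -
    obtain a b c where *: "nf g = a @ c" "nf h = winv c @ b" "nf (g \<otimes> h) = a @ b"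
      "fst ` set a \<subseteq> X" "fst ` set b \<subseteq> X" "fst ` set c \<subseteq> X"
      using nf_mult[OF gh] .
    let ?e = "\<lambda>w. eval H (map (apfst f) w)"
    have e: "?e a \<in> carrier H" "?e b \<in> carrier H" "?e c \<in> carrier H"
      using * by (auto intro!: H.eval_closed cl simp del: set_map)
    have "ext H f g \<otimes>\<^bsub>H\<^esub> ext H f h = (?e a \<otimes>\<^bsub>H\<^esub> ?e c) \<otimes>\<^bsub>H\<^esub> (inv\<^bsub>H\<^esub> ?e c \<otimes>\<^bsub>H\<^esub> ?e b)"
      using * by (simp add: ext_def H.eval_append H.eval_winv cl winv_map del: set_map)
    also have "\<dots> = ?e a \<otimes>\<^bsub>H\<^esub> ((?e c \<otimes>\<^bsub>H\<^esub> inv\<^bsub>H\<^esub> ?e c) \<otimes>\<^bsub>H\<^esub> ?e b)"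
      using e by (simp only: H.m_assoc H.m_closed H.inv_closed)
    also have "\<dots> = ext H f (g \<otimes> h)"
      using * e by (simp add: ext_def H.eval_append cl del: set_map)
    finally show ?thesis ..
  qed
qed

lemma ext_basis:
  assumes "group H" "f ` X \<subseteq> carrier H" "x \<in> X"
  shows "ext H f x = f x"
proof -
  interpret H: group H by fact
  show ?thesis
    using assms by (auto simp: ext_def nf_basis H.eval_Cons letter_def)
qed

lemma hom_eqI:
  assumes "group H" "h \<in> hom G H" "h' \<in> hom G H" "\<And>x. x \<in> X \<Longrightarrow> h x = h' x" "g \<in> carrier G"
  shows "h g = h' g"
proof -
  have "h x = h' x" if "(x, e) \<in> set (nf g)" for x e
    using nf_letters[OF assms(5)] assms(4) that by force
  then have "map (apfst h) (nf g) = map (apfst h') (nf g)"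
    by (auto simp: apfst_def map_prod_def split: prod.splits)
  then have "h (eval G (nf g)) = h' (eval G (nf g))"
    using eval_hom[OF is_group assms(1,2), of "nf g"] eval_hom[OF is_group assms(1,3), of "nf g"]
      word_over_carrier[OF nf_letters[OF assms(5)]] by metis
  then show ?thesis
    by (simp add: eval_nf assms(5))
qed

section \<open>Automorphisms and the primitive elements they produce\<close>

lemma basis_image_iso:
  assumes "h \<in> iso G G"
  shows "free_basis G (h ` X)"
  unfolding free_basis_def
proof (intro conjI allI impI)
  interpret group_hom G G h
    using assms by (simp add: group_hom_def group_hom_axioms_def iso_def is_group)
  have bij: "bij_betw h (carrier G) (carrier G)"
    using assms by (simp add: iso_def)
  show "h ` X \<subseteq> carrier G"
    using X_subset by auto
  show "generate G (h ` X) = carrier G"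
    using generate_img[OF X_subset] basis bij by (simp add: free_basis_def bij_betw_def)
  fix w :: "('a \<times> bool) list" assume w: "w \<noteq> [] \<and> fst ` set w \<subseteq> h ` X \<and> reduced w"
  define k where "k = inv_into X h"
  let ?u = "map (apfst k) w"
  have k: "k x \<in> X \<and> h (k x) = x" if "x \<in> h ` X" for x
    using that by (auto simp: k_def inv_into_into f_inv_into_f)
  have "fst ` set ?u \<subseteq> X"
    using w k by auto
  have w_eq: "w = map (apfst h) ?u"
    using w k by (intro nth_equalityI) (auto simp: prod_eq_iff image_subset_iff)
  have "successively (\<lambda>l m. apfst k m \<noteq> linv (apfst k l)) w"
  proof (rule successively_mono[of "\<lambda>l m. m \<noteq> linv l"])
    show "successively (\<lambda>l m. m \<noteq> linv l) w"
      using w by (simp add: reduced_alt)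
    fix l m assume lm: "l \<in> set w" "m \<in> set w" "m \<noteq> linv l"
    have "h (k (fst l)) = fst l" "h (k (fst m)) = fst m"
      using w k lm by auto
    \<comment> \<open>Injectivity of \<open>k\<close> on the letters of \<open>w\<close> keeps the
      pulled back word reduced.\<close>
    then have "k (fst m) = k (fst l) \<Longrightarrow> fst m = fst l"
      by metis
    then show "apfst k m \<noteq> linv (apfst k l)"
      using lm(3) by (auto simp: linv_def prod_eq_iff)
  qed
  then have "reduced ?u"
    by (simp add: reduced_alt successively_map)
  then have "eval G ?u \<noteq> \<one>" "eval G ?u \<in> carrier G"
    using \<open>fst ` set ?u \<subseteq> X\<close> w eval_neq_one[of ?u] by auto
  then have "h (eval G ?u) \<noteq> \<one>"
    using bij by (metis bij_betw_def hom_one inj_on_def one_closed)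
  then have "eval G w \<noteq> \<one>"
    using eval_hom[OF is_group is_group homh word_over_carrier[OF \<open>fst ` set ?u \<subseteq> X\<close>]] w_eq
    by metis
  then show "word_prod G (map (letter G) w) \<noteq> \<one>"
    by (simp add: eval_def)
qed

text \<open>Both composites of the two extensions fix the basis, so they are the identity by
  \<open>hom_eqI\<close>.\<close>

lemma endo_iso:
  assumes "f ` X \<subseteq> carrier G" "k ` X \<subseteq> carrier G"
    "\<And>x. x \<in> X \<Longrightarrow> ext G k (f x) = x" "\<And>x. x \<in> X \<Longrightarrow> ext G f (k x) = x"
  shows "ext G f \<in> iso G G"
proof (rule group_isomorphisms_imp_iso)
  have hom: "ext G f \<in> hom G G" "ext G k \<in> hom G G"
    using assms by (auto intro!: ext_hom is_group)
  have id: "(\<lambda>x. x) \<in> hom G G"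
    by (auto intro: homI)
  have "(ext G k \<circ> ext G f) x = x" if "x \<in> carrier G" for x
    using hom_eqI[OF is_group Group.hom_compose[OF hom] id _ that] assms
    by (simp add: ext_basis is_group)
  moreover have "(ext G f \<circ> ext G k) x = x" if "x \<in> carrier G" for x
    using hom_eqI[OF is_group Group.hom_compose[OF hom(2,1)] id _ that] assms
    by (simp add: ext_basis is_group)
  ultimately have *: "ext G k (ext G f x) = x" "ext G f (ext G k x) = x" if "x \<in> carrier G" for x
    using that by simp_all
  then show "group_isomorphisms G G (ext G f) (ext G k)"
    using hom by (auto simp: group_isomorphisms_def)
qed

text \<open>Inverting every basis element extends to an automorphism that is its own
  inverse.\<close>

lemma primitive_inv:
  assumes "x \<in> X"
  shows "primitive G (inv x)"
proof -
  have c: "(\<lambda>x. inv x) ` X \<subseteq> carrier G"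
    using X_subset by auto
  interpret h: group_hom G G "ext G (\<lambda>x. inv x)"
    using ext_hom[OF is_group c] by (simp add: group_hom_def group_hom_axioms_def is_group)
  have "ext G (\<lambda>x. inv x) (inv x) = x" if "x \<in> X" for x
    using that X_subset c by (auto simp: ext_basis is_group)
  then have "ext G (\<lambda>x. inv x) \<in> iso G G"
    using c by (intro endo_iso) auto
  from basis_image_iso[OF this] show ?thesis
    unfolding primitive_def using assms ext_basis[OF is_group c assms] by force
qed

text \<open>The map \<open>x \<mapsto> g \<otimes> x\<close> that fixes the rest of the basis
  extends to an automorphism: as \<open>x\<close> does not occur in \<open>g\<close>, it fixes
  \<open>g\<close>, so \<open>x \<mapsto> inv g \<otimes> x\<close> gives its inverse.\<close>

lemma primitive_mult_basis:
  assumes "x \<in> X" "g \<in> carrier G" "x \<notin> fst ` set (nf g)"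
  shows "primitive G (g \<otimes> x)"
proof -
  have xc: "x \<in> carrier G"
    using assms X_subset by auto
  define f where "f a y = (if y = x then a \<otimes> x else y)" for a y
  have c: "f a ` X \<subseteq> carrier G" if "a \<in> carrier G" for a
    using that xc X_subset by (auto simp: f_def)
  have fix_g: "ext G (f a) g = g" if "a \<in> carrier G" for a
  proof -
    have "map (apfst (f a)) (nf g) = nf g"
      using assms(3) by (intro map_idI) (force simp: f_def apfst_def map_prod_def)
    then show ?thesis
      by (simp add: ext_def eval_nf assms)
  qed
  \<comment> \<open>Stated for both \<open>g\<close> and \<open>inv g\<close> in the role of
    \<open>a\<close>, to cover the two composites required by \<open>endo_iso\<close>.\<close>
  have inverse: "ext G (f b) (f a y) = y"
    if ab: "a \<in> {g, inv g}" "b = inv a" and y: "y \<in> X" for a b y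
  proof -
    have ac: "a \<in> carrier G" "b \<in> carrier G"
      using ab assms by auto
    interpret h: group_hom G G "ext G (f b)"
      using ext_hom[OF is_group c[OF ac(2)]] by (simp add: group_hom_def group_hom_axioms_def is_group)
    have "ext G (f b) a = a"
      using ab(1) fix_g[OF ac(2)] assms(2) by auto
    then have "ext G (f b) (a \<otimes> x) = a \<otimes> (b \<otimes> x)"
      using ac xc assms(1) c[OF ac(2)] by (simp add: ext_basis is_group) (simp add: f_def)
    also have "\<dots> = x"
      using ac xc ab by (simp flip: m_assoc)
    finally show ?thesis
      using y c[OF ac(2)] xc by (cases "y = x") (simp_all add: f_def ext_basis is_group)
  qed
  have "ext G (f g) \<in> iso G G"
    using c assms by (intro endo_iso[of "f g" "f (inv g)"] inverse) auto
  from basis_image_iso[OF this] show ?thesis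
    unfolding primitive_def using ext_basis[OF is_group c[OF assms(2)] assms(1)] assms(1)
    by (intro exI[of _ "ext G (f g) ` X"]) (auto simp: f_def image_iff intro!: bexI[of _ x])
qed

end

text \<open>Inner automorphisms map bases to bases; this reduces later arguments to cyclically
  reduced words.\<close>

lemma (in group) primitive_conjugate:
  assumes "primitive G g" "t \<in> carrier G"
  shows "primitive G (inv t \<otimes> g \<otimes> t)"
proof -
  obtain B where B: "free_basis G B" "g \<in> B"
    using assms by (auto simp: primitive_def)
  interpret B: free_on G B
    by unfold_locales (rule B)
  have "(\<lambda>x. inv t \<otimes> x \<otimes> t) \<in> iso G G"
  proof (rule group_isomorphisms_imp_iso)
    have *: "a \<otimes> (inv a \<otimes> x) = x" "inv a \<otimes> (a \<otimes> x) = x" if "a \<in> carrier G" "x \<in> carrier G" for a x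
      using that by (simp_all flip: m_assoc)
    show "group_isomorphisms G G (\<lambda>x. inv t \<otimes> x \<otimes> t) (\<lambda>x. t \<otimes> x \<otimes> inv t)"
      using assms(2) by (auto simp: group_isomorphisms_def m_assoc * intro!: homI)
  qed
  then show ?thesis
    unfolding primitive_def using B.basis_image_iso B(2) by blast
qed


section \<open>Width\<close>

lemma len_le: "set gs \<subseteq> S \<Longrightarrow> len G S (word_prod G gs) \<le> enat (length gs)"
  by (auto simp: len_def intro!: INF_lower)

lemma len_geI:
  assumes "\<And>gs. set gs \<subseteq> S \<Longrightarrow> word_prod G gs = g \<Longrightarrow> n \<le> length gs"
  shows "enat n \<le> len G S g"
  using assms by (auto simp: len_def intro!: INF_greatest)

text \<open>Along a product of \<open>n\<close> elements of \<open>S\<close>, \<open>f\<close> grows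
  at most linearly in \<open>n\<close>, so elements with large \<open>f\<close> need many factors. A
  one-sided quasimorphism bound suffices.\<close>

lemma (in group) width_infinite:
  fixes f :: "'a \<Rightarrow> int"
  assumes S: "S \<subseteq> carrier G"
    and mult: "\<And>g h. g \<in> carrier G \<Longrightarrow> h \<in> carrier G \<Longrightarrow> f (g \<otimes> h) \<le> f g + f h + D"
    and bound: "\<And>s. s \<in> S \<Longrightarrow> f s \<le> C"
    and unbounded: "\<And>n. \<exists>g \<in> carrier G. f g \<ge> int n"
  shows "width G S = \<infinity>"
proof -
  \<comment> \<open>The absolute value makes the bound monotone in the length even if
    \<open>C + D\<close> is negative.\<close>
  have word: "f (word_prod G gs) \<le> \<bar>C + D\<bar> * int (length gs) + f \<one>" if "set gs \<subseteq> S" for gs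
    using that
  proof (induction gs)
    case Nil
    then show ?case by (simp add: word_prod_def)
  next
    case (Cons g gs)
    have "f (word_prod G (g # gs)) \<le> f g + f (word_prod G gs) + D"
      using Cons.prems S mult word_prod_closed[of gs] by (auto simp: word_prod_def)
    also have "\<dots> \<le> C + D + (\<bar>C + D\<bar> * int (length gs) + f \<one>)"
      using Cons bound[of g] by auto
    finally show ?case
      by (simp add: algebra_simps)
  qed
  have "enat n \<le> width G S" for n
  proof -
    obtain g where "g \<in> carrier G" "f g \<ge> int (nat (\<bar>C + D\<bar> * int n + \<bar>f \<one>\<bar> + 1))"
      using unbounded by blast
    then have g: "g \<in> carrier G" "f g \<ge> \<bar>C + D\<bar> * int n + \<bar>f \<one>\<bar> + 1"
      by simp_all
    have "n \<le> length gs" if gs: "set gs \<subseteq> S" "word_prod G gs = g" for gs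
    proof (rule ccontr)
      assume "\<not> n \<le> length gs"
      then have "\<bar>C + D\<bar> * int (length gs) \<le> \<bar>C + D\<bar> * int n"
        by (intro mult_left_mono) auto
      then show False
        using word[OF gs(1), unfolded gs(2)] g(2) abs_ge_self[of "f \<one>"] by linarith
    qed
    then have "enat n \<le> len G S g"
      by (rule len_geI)
    also have "\<dots> \<le> width G S"
      unfolding width_def using g(1) by (rule SUP_upper)
    finally show ?thesis .
  qed
  then show ?thesis
    by (metis enat_ord_simps(5) enat_ord_simps(1) not_less_eq_eq order_refl enat.exhaust)
qed

section \<open>Exponent sums, infinite rank and rank one\<close>

lemma (in group) free_on_hom_int:
  assumes "free_on G B" "b \<in> B"
  obtains \<phi> where "\<phi> \<in> hom G integer_group" "\<And>x. x \<in> B \<Longrightarrow> \<phi> x = 1"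
  using free_on.ext_hom[OF assms(1) group_integer_group, of "\<lambda>_. 1"]
    free_on.ext_basis[OF assms(1) group_integer_group, of "\<lambda>_. 1"] that by simp

lemma (in group) primitive_obtain_basis:
  assumes "primitive G g"
  obtains B where "free_on G B" "g \<in> B"
  using assms by (auto simp: primitive_def free_on_def free_on_axioms_def is_group)

lemma (in group) primitive_carrier: "primitive G g \<Longrightarrow> g \<in> carrier G"
  by (auto simp: primitive_def free_basis_def)

lemma (in group) square_not_primitive:
  assumes "x \<in> carrier G"
  shows "\<not> primitive G (x \<otimes> x)"
proof
  assume "primitive G (x \<otimes> x)"
  then obtain B where B: "free_on G B" "x \<otimes> x \<in> B"
    by (rule primitive_obtain_basis)
  obtain \<phi> where \<phi>: "\<phi> \<in> hom G integer_group" "\<And>x. x \<in> B \<Longrightarrow> \<phi> x = 1"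
    using free_on_hom_int[OF B] by blast
  have "\<phi> (x \<otimes> x) = \<phi> x + \<phi> x"
    using hom_mult[OF \<phi>(1)] assms by simp
  then have "1 = 2 * \<phi> x"
    using \<phi>(2)[OF B(2)] by simp
  then show False
    by presburger
qed

lemma (in free_on) primitive_width_infinite_rank:
  assumes "infinite X"
  shows "primitive_width G = 2"
proof (rule antisym)
  have two: "(2 :: enat) = enat 2"
    by (simp add: numeral_eq_enat)
  show "primitive_width G \<le> 2"
    unfolding primitive_width_def width_def
  proof (rule SUP_least)
    fix g assume g: "g \<in> carrier G"
    have "infinite (X - fst ` set (nf g))"
      using assms by (intro Diff_infinite_finite) auto
    then obtain x where x: "x \<in> X" "x \<notin> fst ` set (nf g)"
      using infinite_imp_nonempty by blast
    then have xc: "x \<in> carrier G"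
      using X_subset by blast
    \<comment> \<open>The factor \<open>inv x\<close> must be primitive in its own right, since
      inverses are not free of charge in \<open>len\<close>.\<close>
    have "word_prod G [g \<otimes> x, inv x] = g"
      using g xc by (simp add: word_prod_def m_assoc)
    then show "len G {g. primitive G g} g \<le> 2"
      using len_le[of "[g \<otimes> x, inv x]" "{g. primitive G g}" G] primitive_inv[OF x(1)]
        primitive_mult_basis[OF x(1) g x(2)] by (simp add: two numeral_2_eq_2)
  qed
  obtain x where x: "x \<in> X"
    using infinite_imp_nonempty[OF assms] by blast
  then have xc: "x \<in> carrier G"
    using X_subset by blast
  have "eval G [(x, True), (x, True)] \<noteq> \<one>"
    using x by (intro eval_neq_one) (auto simp: reduced_Cons linv_def)
  then have "x \<otimes> x \<noteq> \<one>"
    using xc by (simp add: eval_Cons letter_def)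
  \<comment> \<open>The case rule separates words of length zero, one and at least two: the empty
    word has value \<open>\<one>\<close>, and a single primitive factor cannot be a square.\<close>
  then have "2 \<le> length gs" if "set gs \<subseteq> {g. primitive G g}" "word_prod G gs = x \<otimes> x" for gs
    using that square_not_primitive[OF xc] primitive_carrier
    by (cases gs rule: remdups_adj.cases) (auto simp: word_prod_def)
  then have "enat 2 \<le> len G {g. primitive G g} (x \<otimes> x)"
    by (rule len_geI)
  also have "\<dots> \<le> primitive_width G"
    unfolding primitive_width_def width_def using xc by (intro SUP_upper) auto
  finally show "2 \<le> primitive_width G"
    by (simp add: two)
qed

text \<open>In an infinite cyclic group only the generator and its inverse can be primitive, so the
  exponent sum is at most 1 on primitive elements, while it is unbounded and additive.\<close>

lemma (in free_on) primitive_width_cyclic: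
  assumes "X = {x}"
  shows "primitive_width G = \<infinity>"
  unfolding primitive_width_def
proof -
  have x: "x \<in> X"
    using assms by simp
  then have xc: "x \<in> carrier G"
    using X_subset by blast
  obtain f where f: "f \<in> hom G integer_group" "\<And>y. y \<in> X \<Longrightarrow> f y = 1"
    using free_on_hom_int[OF free_on_axioms x] by blast
  have pow: "\<phi> (x [^] (k::int)) = k * \<phi> x" if "\<phi> \<in> hom G integer_group" for \<phi> k
    using hom_int_pow[OF that xc] by (simp add: is_group)
  show "width G {g. primitive G g} = \<infinity>"
  proof (rule width_infinite[where f = f and C = 1 and D = 0])
    show "f (g \<otimes> h) \<le> f g + f h + 0" if "g \<in> carrier G" "h \<in> carrier G" for g h
      using hom_mult[OF f(1) that] by simp
    show "\<exists>g\<in>carrier G. int n \<le> f g" for n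
      using pow[OF f(1), of "int n"] f(2)[OF x] xc by (intro bexI[of _ "x [^] int n"]) auto
    show "f g \<le> 1" if g: "g \<in> {g. primitive G g}" for g
    proof -
      obtain B where B: "free_on G B" "g \<in> B"
        using g by (auto elim: primitive_obtain_basis)
      obtain \<phi> where \<phi>: "\<phi> \<in> hom G integer_group" "\<And>x. x \<in> B \<Longrightarrow> \<phi> x = 1"
        using free_on_hom_int[OF B] by blast
      have "g \<in> generate G {x}"
        using g basis primitive_carrier assms by (auto simp: free_basis_def)
      then obtain k :: int where k: "g = x [^] k"
        using generate_pow[OF xc] by auto
      \<comment> \<open>The exponent sum for the basis through \<open>g\<close> shows that
        \<open>k\<close> is a unit of the integers.\<close>
      have "k * \<phi> x = 1"
        using pow[OF \<phi>(1)] \<phi>(2)[OF B(2)] k by simp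
      then have "k = 1 \<or> k = -1"
        by (auto simp: zmult_eq_1_iff)
      then show ?thesis
        using pow[OF f(1)] f(2)[OF x] k by auto
    qed
  qed (auto intro: primitive_carrier)
qed

text \<open>The basis elements that occur in a finite generating set already generate; by uniqueness
  of normal forms, no further basis element is a word in them.\<close>

lemma (in free_on) finite_basis:
  assumes "finitely_generated G"
  shows "finite X"
proof -
  obtain S where S: "finite S" "S \<subseteq> carrier G" "generate G S = carrier G"
    using assms by (auto simp: finitely_generated_def)
  define X0 where "X0 = (\<Union>s\<in>S. fst ` set (nf s))"
  have X0: "X0 \<subseteq> X" "finite X0"
    using S nf_letters by (force simp: X0_def)+
  have "S \<subseteq> generate G X0"
  proof
    fix s assume "s \<in> S"
    then have "eval G (nf s) \<in> generate G X0"
      by (intro eval_in_generate) (auto simp: X0_def)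
    then show "s \<in> generate G X0"
      using S(2) \<open>s \<in> S\<close> eval_nf by auto
  qed
  moreover have sub: "subgroup (generate G X0) G"
    using X0 X_subset by (intro generate_is_subgroup) auto
  ultimately have gen: "carrier G \<subseteq> generate G X0"
    using generate_subgroup_incl S(3) by metis
  have "X \<subseteq> X0"
  proof
    fix x assume x: "x \<in> X"
    then have "x \<in> generate G X0"
      using gen X_subset by blast
    then obtain w where w: "fst ` set w \<subseteq> X0" "eval G w = x"
      using X0 X_subset by (meson generate_obtain_word order_trans)
    then obtain u where u: "reduced u" "fst ` set u \<subseteq> fst ` set w" "eval G u = x"
      using X0 X_subset eval_reduce[of w] by (metis order_trans)
    then have "nf x = u"
      using w X0 by (intro nf_eqI) auto
    then show "x \<in> X0"
      using u w nf_basis[OF x] by auto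
  qed
  then show ?thesis
    using X0 finite_subset by blast
qed

section \<open>Almost invariant sets and primitive elements\<close>

text \<open>Almost invariant sets as in the theory of ends. Quantifying over all group elements
  makes the notion independent of a basis: such a set is built from one basis and examined in
  another.\<close>

definition almost_invariant :: "('a, 'b) monoid_scheme \<Rightarrow> 'a set \<Rightarrow> bool" where
  "almost_invariant G Y \<longleftrightarrow>
     (\<forall>s \<in> carrier G. finite {h \<in> carrier G. (h \<in> Y) \<noteq> (h \<otimes>\<^bsub>G\<^esub> s \<in> Y)})"

lemma (in group) almost_invariant_complement:
  assumes "almost_invariant G Y"
  shows "almost_invariant G (carrier G - Y)"
proof -
  have "{h \<in> carrier G. (h \<in> carrier G - Y) \<noteq> (h \<otimes> s \<in> carrier G - Y)} =
        {h \<in> carrier G. (h \<in> Y) \<noteq> (h \<otimes> s \<in> Y)}" if "s \<in> carrier G" for s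
    using that by auto
  then show ?thesis
    using assms by (simp add: almost_invariant_def)
qed

text \<open>A change of membership along \<open>l # w\<close> happens either along \<open>l\<close>
  or, after an injective translation, along \<open>w\<close>.\<close>

lemma (in free_on) almost_invariantI:
  assumes "\<And>l. fst l \<in> X \<Longrightarrow> finite {h \<in> carrier G. (h \<in> Y) \<noteq> (h \<otimes> letter G l \<in> Y)}"
  shows "almost_invariant G Y"
  unfolding almost_invariant_def
proof
  let ?D = "\<lambda>s. {h \<in> carrier G. (h \<in> Y) \<noteq> (h \<otimes> s \<in> Y)}"
  fix s assume s: "s \<in> carrier G"
  have "finite (?D (eval G w))" if "fst ` set w \<subseteq> X" for w
    using that
  proof (induction w)
    case Nil
    have "?D (eval G []) = {}"
      by auto
    then show ?case
      by (metis finite.emptyI)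
  next
    case (Cons l w)
    have l: "letter G l \<in> carrier G" "eval G w \<in> carrier G"
      using Cons.prems X_subset by (auto intro: letter_closed)
    define E where "E = {h \<in> carrier G. h \<otimes> letter G l \<in> ?D (eval G w)}"
    have "finite (?D (eval G w))"
      using Cons by simp
    moreover have "inj_on (\<lambda>h. h \<otimes> letter G l) E"
      using l by (auto simp: E_def intro!: inj_onI)
    moreover have "(\<lambda>h. h \<otimes> letter G l) ` E \<subseteq> ?D (eval G w)"
      by (auto simp: E_def)
    ultimately have "finite E"
      using finite_imageD finite_subset by blast
    moreover have "finite (?D (letter G l))"
      using assms Cons.prems by simp
    moreover have "?D (eval G (l # w)) \<subseteq> E \<union> ?D (letter G l)"
      using l by (auto simp: E_def eval_Cons m_assoc)
    ultimately show ?case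
      by (meson finite_UnI finite_subset)
  qed
  from this[OF nf_letters[OF s]] show "finite (?D s)"
    by (simp add: eval_nf s)
qed

text \<open>
  The witness is the set of elements whose normal form starts with another basis element \<open>b\<close>:
  right multiplication by \<open>g\<close> never changes the first letter from or into \<open>b\<close>.
\<close>

lemma (in free_on) basis_almost_invariant:
  assumes "g \<in> X" "b \<in> X" "g \<noteq> b"
  obtains Y where "almost_invariant G Y" "infinite (Y \<inter> carrier G)" "infinite (carrier G - Y)"
    "\<And>h. h \<in> carrier G \<Longrightarrow> h \<otimes> g \<in> Y \<longleftrightarrow> h \<in> Y"
proof
  define Y where "Y = {h. nf h \<noteq> [] \<and> hd (nf h) = (b, True)}"
  \<comment> \<open>Membership changes only on the edge between \<open>\<one>\<close> and
    \<open>b\<close>, in either direction.\<close>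
  have step: "(h \<otimes> letter G l \<in> Y \<longleftrightarrow> h \<in> Y) \<or> (nf h = [] \<and> l = (b, True)) \<or>
      (nf (h \<otimes> letter G l) = [] \<and> l = (b, False))"
    if "h \<in> carrier G" "fst l \<in> X" for h l
    using nf_snoc[OF that]
  proof
    assume "nf (h \<otimes> letter G l) = nf h @ [l]"
    then show ?thesis
      by (cases "nf h") (auto simp: Y_def)
  next
    assume *: "nf h = nf (h \<otimes> letter G l) @ [linv l]"
    show ?thesis
    proof (cases "nf (h \<otimes> letter G l)")
      case Nil
      then show ?thesis
        using * by (cases l) (auto simp: Y_def linv_def)
    next
      case (Cons m t)
      then show ?thesis
        using * by (simp add: Y_def)
    qed
  qed
  show "almost_invariant G Y"
  proof (rule almost_invariantI)
    fix l :: "'a \<times> bool" assume l: "fst l \<in> X"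
    then have lc: "letter G l \<in> carrier G"
      using X_subset by (auto intro: letter_closed)
    have "{h \<in> carrier G. (h \<in> Y) \<noteq> (h \<otimes> letter G l \<in> Y)} \<subseteq> {\<one>, inv (letter G l)}"
    proof
      fix h assume h: "h \<in> {h \<in> carrier G. (h \<in> Y) \<noteq> (h \<otimes> letter G l \<in> Y)}"
      then have "nf h = [] \<or> nf (h \<otimes> letter G l) = []"
        using step[of h l] l by auto
      then have "h = \<one> \<or> h \<otimes> letter G l = \<one>"
        using h lc by (auto simp: nf_eq_Nil)
      then show "h \<in> {\<one>, inv (letter G l)}"
        using h lc inv_equality by fastforce
    qed
    then show "finite {h \<in> carrier G. (h \<in> Y) \<noteq> (h \<otimes> letter G l \<in> Y)}"
      by (rule finite_subset) simp
  qed
  show "h \<otimes> g \<in> Y \<longleftrightarrow> h \<in> Y" if "h \<in> carrier G" for h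
    using step[OF that, of "(g, True)"] assms by (simp add: letter_def)
  \<comment> \<open>Positive powers of \<open>b\<close> lie in \<open>Y\<close>, negative ones
    outside; \<open>Suc k\<close> excludes the identity.\<close>
  define z where "z e k = eval G (replicate (Suc k) (b, e))" for e k
  have red: "reduced (replicate k (b, e))" for k e
  proof (induction k)
    case (Suc k)
    then show ?case
      by (cases k) (auto simp: reduced_Cons linv_def)
  qed simp
  have nf_z: "nf (z e k) = replicate (Suc k) (b, e)" for e k
    unfolding z_def using assms by (intro nf_eval red) auto
  have inf: "infinite (range (z e))" for e
  proof (rule range_inj_infinite, rule injI)
    fix i j assume "z e i = z e j"
    then have "replicate (Suc i) (b, e) = replicate (Suc j) (b, e)"
      using nf_z by metis
    then show "i = j"
      by (metis length_replicate nat.inject)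
  qed
  have zc: "z e k \<in> carrier G" for e k
    unfolding z_def using assms by (intro eval_carrier) auto
  have "range (z True) \<subseteq> Y \<inter> carrier G" "range (z False) \<subseteq> carrier G - Y"
    using zc by (auto simp: Y_def nf_z)
  then show "infinite (Y \<inter> carrier G)" "infinite (carrier G - Y)"
    using inf infinite_super by blast+
qed


section \<open>Turns of primitive elements\<close>

context free_on
begin

text \<open>The vertices of the Cayley tree that are separated from \<open>\<one>\<close> by the
  vertex of \<open>h\<close>, together with that vertex, if \<open>h\<close> is a reduced word over
  \<open>X\<close>.\<close>

definition cone :: "('a \<times> bool) list \<Rightarrow> 'a set" where
  "cone h = {k \<in> carrier G. prefix h (nf k)}"

text \<open>
  With \<open>w' = c # q @ p\<close>, the elements \<open>h w'\<^sup>k\<close> are \<open>u w\<^sup>k p\<close> for \<open>u = h p\<^sup>-\<^sup>1\<close>; they all lie in the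
  cone of \<open>h c\<close>, and all but finitely many of them lie in \<open>Y\<close> if \<open>u\<close> does.
\<close>

lemma cone_infinite:
  assumes Y: "almost_invariant G Y"
    and w: "fst ` set (p @ c # q) \<subseteq> X" "p \<noteq> []" "reduced ((p @ c # q) @ (p @ c # q))"
    and inv_w: "\<And>h. h \<in> carrier G \<Longrightarrow> h \<otimes> eval G (p @ c # q) \<in> Y \<longleftrightarrow> h \<in> Y"
    and h: "fst ` set h \<subseteq> X" "reduced (h @ [c])"
    and u: "eval G h \<otimes> inv (eval G p) \<in> Y"
  shows "infinite (cone (h @ [c]) \<inter> Y)"
proof -
  define w' where "w' = c # q @ p"
  define z where "z k = eval G (h @ concat (replicate (Suc k) w'))" for k
  define W where "W = eval G (p @ c # q)"
  have letters: "fst ` set p \<subseteq> X" "fst ` set (c # q) \<subseteq> X" "fst ` set w' \<subseteq> X"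
    using w(1) by (auto simp: w'_def)
  then have letters_pow: "fst ` set (concat (replicate k w')) \<subseteq> X" for k
    by (induction k) (auto simp: image_Un)
  have closed: "eval G p \<in> carrier G" "eval G h \<in> carrier G" "W \<in> carrier G"
    unfolding W_def using letters h w by auto
  have "reduced (w' @ w')"
    using w(2,3) by (auto simp: w'_def reduced_append reduced_Cons hd_append split: if_splits)
  then have red: "reduced (h @ concat (replicate (Suc k) w'))" for k
    using reduced_power[of w' "Suc k"] h(2) by (auto simp: reduced_append w'_def)
  have z_letters: "fst ` set (h @ concat (replicate k w')) \<subseteq> X" for k
    using h(1) letters_pow[of k] by (simp only: set_append image_Un Un_subset_iff simp_thms)
  have z_closed: "z k \<in> carrier G" for k
    unfolding z_def using z_letters by (rule eval_carrier)
  have nf_z: "nf (z k) = h @ concat (replicate (Suc k) w')" for k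
    unfolding z_def by (intro nf_eval red z_letters)
  have "inj z"
  proof (rule injI)
    fix i j assume "z i = z j"
    then have "length (concat (replicate (Suc i) w')) = length (concat (replicate (Suc j) w'))"
      using nf_z by (metis same_append_eq)
    then have "Suc i * length w' = Suc j * length w'"
      by (simp only: length_concat map_replicate sum_list_replicate) simp
    moreover have "length w' \<noteq> 0"
      by (simp add: w'_def)
    ultimately show "i = j"
      by (metis mult_cancel2 nat.inject)
  qed
  then have inf: "infinite (range z)"
    by (rule range_inj_infinite)
  \<comment> \<open>Here \<open>p w'\<^sup>k = w\<^sup>k p\<close> for \<open>w = p @ c # q\<close>,
    so the product is \<open>v w\<^sup>k\<close> and invariance under \<open>w\<close> applies
    \<open>k\<close> times.\<close>
  have shift: "v \<otimes> eval G (p @ concat (replicate k w')) \<otimes> inv (eval G p) \<in> Y \<longleftrightarrow> v \<in> Y"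
    if "v \<in> carrier G" for v k
    using that
  proof (induction k arbitrary: v)
    case 0
    then show ?case
      using closed by (simp add: m_assoc)
  next
    case (Suc k)
    have "p @ concat (replicate (Suc k) w') = (p @ c # q) @ p @ concat (replicate k w')"
      by (simp add: w'_def)
    then have "eval G (p @ concat (replicate (Suc k) w')) = W \<otimes> eval G (p @ concat (replicate k w'))"
      unfolding W_def using w(1) letters letters_pow by (simp only: eval_app set_append image_Un Un_subset_iff)
    moreover have "eval G (p @ concat (replicate k w')) \<in> carrier G"
      using letters letters_pow by (intro eval_carrier) (simp add: image_Un)
    ultimately have "v \<otimes> eval G (p @ concat (replicate (Suc k) w')) =
        (v \<otimes> W) \<otimes> eval G (p @ concat (replicate k w'))"
      using Suc.prems closed by (simp add: m_assoc)
    then show ?case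
      using Suc closed inv_w by (simp add: W_def)
  qed
  have z_eq: "z k = eval G h \<otimes> inv (eval G p) \<otimes> eval G (p @ concat (replicate (Suc k) w'))" for k
    unfolding z_def using h letters letters_pow closed
    by (simp only: eval_app) (simp add: m_assoc inv_solve_left del: concat.simps replicate.simps)
  then have "z k \<otimes> inv (eval G p) \<in> Y" for k
    using shift[of "eval G h \<otimes> inv (eval G p)" "Suc k"] u closed by simp
  \<comment> \<open>Multiplying by the fixed element \<open>inv (eval G p)\<close> brings every
    \<open>z k\<close> into \<open>Y\<close>, so almost invariance leaves only finitely many
    exceptions.\<close>
  then have "range z - Y \<subseteq> {h \<in> carrier G. (h \<in> Y) \<noteq> (h \<otimes> inv (eval G p) \<in> Y)}"
    using z_closed by auto
  then have "finite (range z - Y)"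
    using Y closed by (auto simp: almost_invariant_def intro: finite_subset)
  then have "infinite (range z \<inter> Y)"
    using inf by (metis Int_Diff_Un finite_UnI)
  moreover have "range z \<inter> Y \<subseteq> cone (h @ [c]) \<inter> Y"
    using z_closed nf_z by (auto simp: cone_def w'_def)
  ultimately show ?thesis
    using infinite_super by blast
qed

text \<open>The translate of the axis of \<open>w\<close> that passes through \<open>h\<close> at
  the turn \<open>d\<close>, \<open>c\<close> leaves along \<open>c\<close> forwards and along
  \<open>linv d\<close> backwards. Invariance under \<open>w\<close> puts both of its ends on the
  same side of \<open>Y\<close>.\<close>

lemma turn_same_side:
  assumes Y: "almost_invariant G Y"
    and w: "w = p @ d # c # q" "fst ` set w \<subseteq> X" "reduced (w @ w)"
    and inv_w: "\<And>h. h \<in> carrier G \<Longrightarrow> h \<otimes> eval G w \<in> Y \<longleftrightarrow> h \<in> Y"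
    and h: "fst ` set h \<subseteq> X" "reduced (h @ [c])" "reduced (h @ [linv d])"
  shows "infinite (cone (h @ [c]) \<inter> Y) \<and> infinite (cone (h @ [linv d]) \<inter> Y) \<or>
    infinite (cone (h @ [c]) - Y) \<and> infinite (cone (h @ [linv d]) - Y)"
proof -
  let ?S = "eval G (p @ [d])" and ?R = "eval G (winv q @ [linv c])"
  define u where "u = eval G h \<otimes> inv ?S"
  define v where "v = eval G h \<otimes> inv ?R"
  have Wc: "eval G w \<in> carrier G" "?S \<in> carrier G" "eval G (c # q) \<in> carrier G" "eval G h \<in> carrier G"
    using w h by (auto intro!: eval_carrier simp: image_Un)
  then have uc: "u \<in> carrier G"
    by (simp add: u_def)
  have inv_winv: "h \<otimes> eval G (winv w) \<in> Y \<longleftrightarrow> h \<in> Y" if "h \<in> carrier G" for h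
    using inv_w[of "h \<otimes> inv (eval G w)"] that Wc w(2) by (simp add: eval_inv m_assoc)
  have R: "?R = inv (eval G (c # q))"
    using w by (subst eval_inv[symmetric]) auto
  have "eval G w = ?S \<otimes> eval G (c # q)"
    using w by (subst eval_app[symmetric]) auto
  \<comment> \<open>The base points for reading \<open>w\<close> forwards and \<open>winv w\<close>
    backwards are one period apart, hence on the same side.\<close>
  then have "v = u \<otimes> eval G w"
    using Wc by (simp add: u_def v_def R m_assoc) (simp flip: m_assoc)
  then have uv: "v \<in> Y \<longleftrightarrow> u \<in> Y"
    using inv_w[OF uc] by simp
  have vc: "v \<in> carrier G"
    using \<open>v = u \<otimes> eval G w\<close> uc Wc by simp
  have winv_w: "winv w = (winv q @ [linv c]) @ linv d # winv p"
    using w by simp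
  have winv_letters: "fst ` set (winv w) \<subseteq> X"
    using w(2) by simp
  have red: "reduced (winv w @ winv w)"
    using w(3) by (metis reduced_winv winv_simps(3))
  \<comment> \<open>A general \<open>Z\<close> allows both \<open>Y\<close> and its complement. The
    second cone comes from \<open>cone_infinite\<close> for \<open>winv w\<close>.\<close>
  have side: "infinite (cone (h @ [c]) \<inter> Z) \<and> infinite (cone (h @ [linv d]) \<inter> Z)"
    if Z: "almost_invariant G Z" "u \<in> Z" "v \<in> Z"
      "\<And>h. h \<in> carrier G \<Longrightarrow> h \<otimes> eval G w \<in> Z \<longleftrightarrow> h \<in> Z"
      "\<And>h. h \<in> carrier G \<Longrightarrow> h \<otimes> eval G (winv w) \<in> Z \<longleftrightarrow> h \<in> Z" for Z
  proof
    show "infinite (cone (h @ [c]) \<inter> Z)"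
      by (rule cone_infinite[where p = "p @ [d]" and q = q])
         (use Z w h in \<open>auto simp: u_def\<close>)
    show "infinite (cone (h @ [linv d]) \<inter> Z)"
      by (rule cone_infinite[where p = "winv q @ [linv c]" and q = "winv p"])
         (use Z h red winv_letters in \<open>simp_all only: v_def winv_w[symmetric] append_is_Nil_conv list.simps simp_thms not_False_eq_True\<close>)
  qed
  show ?thesis
  proof (cases "u \<in> Y")
    case True
    then show ?thesis
      using side[of Y] Y uv inv_w inv_winv by blast
  next
    case False
    have *: "h \<otimes> s \<in> carrier G - Y \<longleftrightarrow> h \<in> carrier G - Y"
      if "h \<in> carrier G" "s \<in> carrier G" "h \<otimes> s \<in> Y \<longleftrightarrow> h \<in> Y" for h s
      using that by auto
    have "eval G (winv w) \<in> carrier G"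
      using winv_letters by (rule eval_carrier)
    then have "infinite (cone (h @ [c]) \<inter> (carrier G - Y)) \<and>
        infinite (cone (h @ [linv d]) \<inter> (carrier G - Y))"
      using False uc vc uv Wc Y inv_w inv_winv
      by (intro side almost_invariant_complement *) auto
    moreover have "cone k \<inter> (carrier G - Y) = cone k - Y" for k
      by (auto simp: cone_def)
    ultimately show ?thesis
      by simp
  qed
qed

lemma cone_subset_children:
  "cone h \<subseteq> insert (eval G h) (\<Union>l \<in> {l. fst l \<in> X \<and> reduced (h @ [l])}. cone (h @ [l]))"
proof
  fix k assume k: "k \<in> cone h"
  then have kc: "k \<in> carrier G" and "\<exists>t. nf k = h @ t"
    by (auto simp: cone_def prefix_def)
  then obtain t where t: "nf k = h @ t"
    by blast
  show "k \<in> insert (eval G h) (\<Union>l \<in> {l. fst l \<in> X \<and> reduced (h @ [l])}. cone (h @ [l]))"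
  proof (cases t)
    case Nil
    then show ?thesis
      using eval_nf[OF kc] t by simp
  next
    case (Cons l t')
    then have "nf k = (h @ [l]) @ t'"
      using t by simp
    moreover from this have "reduced (h @ [l])" "fst l \<in> X"
      using nf_reduced[OF kc] nf_letters[OF kc] by (metis reduced_append, auto)
    ultimately show ?thesis
      using kc by (auto simp: cone_def prefix_def)
  qed
qed

text \<open>For finite \<open>X\<close>, membership in \<open>Y\<close> changes along finitely many
  edges only, and a cone beyond all of them contains no such edge.\<close>

lemma almost_invariant_pure_cone:
  assumes "finite X" "almost_invariant G Y"
  obtains N where "\<And>h. fst ` set h \<subseteq> X \<Longrightarrow> N < length h \<Longrightarrow> cone h \<subseteq> Y \<or> cone h \<inter> Y = {}"
proof -
  define D where "D = (\<Union>l \<in> X \<times> UNIV. {h \<in> carrier G. (h \<in> Y) \<noteq> (h \<otimes> letter G l \<in> Y)})"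
  have "letter G l \<in> carrier G" if "l \<in> X \<times> UNIV" for l
    using that X_subset by (intro letter_closed) auto
  then have "finite D"
    unfolding D_def using assms by (intro finite_UN_I) (auto simp: almost_invariant_def)
  then obtain N where N: "\<And>k. k \<in> D \<Longrightarrow> length (nf k) \<le> N"
    using finite_nat_set_iff_bounded_le[of "(\<lambda>k. length (nf k)) ` D"] by auto
  have *: "eval G (h @ t) \<in> Y \<longleftrightarrow> eval G h \<in> Y"
    if "N < length h" "reduced (h @ t)" "fst ` set (h @ t) \<subseteq> X" for h t
    using that
  proof (induction t rule: rev_induct)
    case (snoc l t)
    have X: "fst ` set (h @ t) \<subseteq> X" "fst l \<in> X" and red: "reduced (h @ t)"
      using snoc.prems by (auto simp: reduced_append)
    have "nf (eval G (h @ t)) = h @ t"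
      using red X by (intro nf_eval)
    then have "eval G (h @ t) \<notin> D"
      using N[of "eval G (h @ t)"] snoc.prems by auto
    then have "eval G (h @ t) \<in> Y \<longleftrightarrow> eval G (h @ t) \<otimes> letter G l \<in> Y"
      using X eval_carrier[OF X(1)] by (cases l) (auto simp: D_def)
    moreover have "eval G (h @ t @ [l]) = eval G (h @ t) \<otimes> eval G [l]"
      using X by (subst eval_app[symmetric]) auto
    moreover have "eval G [l] = letter G l"
      using X X_subset by (auto simp: eval_Cons intro!: r_one letter_closed)
    ultimately show ?case
      using snoc.IH snoc.prems(1) red X by simp
  qed simp
  have "cone h \<subseteq> Y \<or> cone h \<inter> Y = {}" if "fst ` set h \<subseteq> X" "N < length h" for h
  proof -
    have "k \<in> Y \<longleftrightarrow> eval G h \<in> Y" if k: "k \<in> cone h" for k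
    proof -
      have kc: "k \<in> carrier G" and "\<exists>t. nf k = h @ t"
        using k by (auto simp: cone_def prefix_def)
      then obtain t where t: "nf k = h @ t"
        by blast
      show ?thesis
        using *[of h t] eval_nf[OF kc] nf_reduced[OF kc] nf_letters[OF kc] t \<open>N < length h\<close> by simp
    qed
    then show ?thesis by blast
  qed
  then show thesis using that by blast
qed

text \<open>
  Take a cone that \<open>Y\<close> splits while it does not split any of the next smaller cones, up to finite
  sets. Those are indexed by all letters except possibly one, and every turn of \<open>w\<close> forces two of
  them onto the same side. The turns considered here form a complete bipartite graph between the
  positive and the negative letters, which stays connected when a vertex is removed
  (Whitehead's cut vertex argument).
\<close>

lemma no_full_turns:
  assumes X: "finite X" "x \<in> X" "y \<in> X" "x \<noteq> y"
    and Y: "almost_invariant G Y" "infinite (Y \<inter> carrier G)" "infinite (carrier G - Y)"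
    and w: "fst ` set w \<subseteq> X" "reduced (w @ w)"
    and inv_w: "\<And>h. h \<in> carrier G \<Longrightarrow> h \<otimes> eval G w \<in> Y \<longleftrightarrow> h \<in> Y"
    and full: "\<And>a b. a \<in> X \<Longrightarrow> b \<in> X \<Longrightarrow> \<exists>p q. w = p @ (a, True) # (b, True) # q"
  shows False
proof -
  define split where "split h \<longleftrightarrow> fst ` set h \<subseteq> X \<and> reduced h \<and>
    infinite (cone h \<inter> Y) \<and> infinite (cone h - Y)" for h
  have "cone [] = carrier G"
    by (auto simp: cone_def)
  then have "split []"
    using Y by (simp add: split_def Int_commute)
  obtain N where N: "\<And>h. fst ` set h \<subseteq> X \<Longrightarrow> N < length h \<Longrightarrow> cone h \<subseteq> Y \<or> cone h \<inter> Y = {}"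
    using almost_invariant_pure_cone X(1) Y(1) by blast
  have bound: "length h \<le> N" if "split h" for h
  proof (rule ccontr)
    assume "\<not> length h \<le> N"
    then have "cone h - Y = {} \<or> cone h \<inter> Y = {}"
      using N[of h] that by (auto simp: split_def)
    then show False
      using that by (metis split_def finite.emptyI)
  qed
  \<comment> \<open>A split cone as deep as possible; \<open>Suc N\<close> appears because the bound
    in the library rule is strict.\<close>
  have "\<exists>h. split h \<and> (\<forall>k. split k \<longrightarrow> length k \<le> length h)"
    using \<open>split []\<close> bound by (intro ex_has_greatest_nat[of split "[]" length "Suc N"]) (auto simp: less_Suc_eq_le)
  then obtain h where h: "split h" and h_max: "\<And>k. split k \<Longrightarrow> length k \<le> length h"
    by metis
  define L where "L = {l. fst l \<in> X \<and> reduced (h @ [l])}"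
  define inside where "inside l \<longleftrightarrow> finite (cone (h @ [l]) - Y)" for l
  have finL: "finite L"
    by (rule finite_subset[of _ "X \<times> UNIV"]) (use X in \<open>auto simp: L_def\<close>)
  have pure: "inside l \<or> finite (cone (h @ [l]) \<inter> Y)" if "l \<in> L" for l
    using h_max[of "h @ [l]"] h that by (auto simp: split_def inside_def L_def image_Un)
  \<comment> \<open>The turn \<open>(a, True)\<close>, \<open>(b, True)\<close> of \<open>w\<close>
    is an edge of the Whitehead graph between \<open>(b, True)\<close> and
    \<open>(a, False)\<close>.\<close>
  have turn: "inside (b, True) \<longleftrightarrow> inside (a, False)" if "(a, False) \<in> L" "(b, True) \<in> L" for a b
  proof -
    have ab: "a \<in> X" "b \<in> X"
      using that by (auto simp: L_def)
    then obtain p q where pq: "w = p @ (a, True) # (b, True) # q"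
      using full by blast
    have linv_a: "linv (a, True) = (a, False)"
      by (simp add: linv_def)
    have "infinite (cone (h @ [(b, True)]) \<inter> Y) \<and> infinite (cone (h @ [(a, False)]) \<inter> Y) \<or>
      infinite (cone (h @ [(b, True)]) - Y) \<and> infinite (cone (h @ [(a, False)]) - Y)"
      using turn_same_side[OF Y(1) pq w inv_w, of h] h that
      by (simp add: split_def L_def linv_a)
    then show ?thesis
      using pure that by (auto simp: inside_def)
  qed
  \<comment> \<open>Only the inverse of the last letter of \<open>h\<close> can be missing from
    \<open>L\<close>, so two basis elements leave a letter of each sign.\<close>
  have child: "(x, e) \<in> L \<or> (y, e) \<in> L" for e
    using h X by (auto simp: L_def split_def reduced_append reduced_Cons linv_def)
  then obtain a b where ab: "(a, False) \<in> L" "(b, True) \<in> L"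
    by blast
  have same: "inside l \<longleftrightarrow> inside (b, True)" if "l \<in> L" for l
    using turn ab that by (cases l) (metis (full_types))
  show False
  \<comment> \<open>Now all children lie on one side up to finite sets, so \<open>h\<close> itself
    is not split.\<close>
  proof (cases "inside (b, True)")
    case True
    have "cone h - Y \<subseteq> insert (eval G h) (\<Union>l \<in> L. cone (h @ [l]) - Y)"
      using cone_subset_children[of h] by (auto simp: L_def)
    moreover have "finite (insert (eval G h) (\<Union>l \<in> L. cone (h @ [l]) - Y))"
      using finL same True by (intro finite.insertI finite_UN_I) (auto simp: inside_def)
    ultimately show False
      using h finite_subset by (auto simp: split_def)
  next
    case False
    have "cone h \<inter> Y \<subseteq> insert (eval G h) (\<Union>l \<in> L. cone (h @ [l]) \<inter> Y)"
      using cone_subset_children[of h] by (auto simp: L_def)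
    moreover have "finite (insert (eval G h) (\<Union>l \<in> L. cone (h @ [l]) \<inter> Y))"
      using finL same pure False by (intro finite.insertI finite_UN_I) auto
    ultimately show False
      using h finite_subset by (auto simp: split_def)
  qed
qed

text \<open>A one-element basis would make the group cyclic, but \<open>x\<close> and
  \<open>y\<close> do not commute. The second element is needed to build the almost invariant
  set.\<close>

lemma not_singleton_basis:
  assumes "x \<in> X" "y \<in> X" "x \<noteq> y" "free_on G B" "g \<in> B"
  obtains b where "b \<in> B" "b \<noteq> g"
proof -
  interpret B: free_on G B by fact
  have c: "x \<in> carrier G" "y \<in> carrier G" "g \<in> carrier G"
    using assms X_subset B.X_subset by auto
  have "B \<noteq> {g}"
  proof
    assume "B = {g}"
    then have "carrier G = generate G {g}"
      using B.basis by (simp add: free_basis_def)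
    then obtain i j :: int where ij: "x = g [^] i" "y = g [^] j"
      using generate_pow[OF c(3)] c by auto
    then have "x \<otimes> y = y \<otimes> x"
      using c(3) by (simp add: int_pow_mult[symmetric] add.commute)
    then have "eval G [(x, True), (y, True)] = eval G [(y, True), (x, True)]"
      using c by (simp add: eval_Cons letter_def)
    then have "[(x, True), (y, True)] = [(y, True), (x, True)]"
      using assms by (intro eval_inj) (auto simp: reduced_Cons linv_def)
    then show False
      using assms by simp
  qed
  then show thesis
    using assms(5) that by blast
qed

text \<open>The two bases meet here: \<open>Y\<close> comes from a basis through the value of
  \<open>w\<close>, the turns are read in \<open>X\<close>.\<close>

lemma primitive_not_full_turns:
  assumes "finite X" "x \<in> X" "y \<in> X" "x \<noteq> y"
    and w: "fst ` set w \<subseteq> X" "reduced (w @ w)" "primitive G (eval G w)"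
  obtains a b where "a \<in> X" "b \<in> X" "\<And>p q. w \<noteq> p @ (a, True) # (b, True) # q"
proof -
  obtain B where B: "free_on G B" "eval G w \<in> B"
    using w(3) by (rule primitive_obtain_basis)
  obtain b where b: "b \<in> B" "b \<noteq> eval G w"
    using not_singleton_basis[OF assms(2-4) B] .
  obtain Y where Y: "almost_invariant G Y" "infinite (Y \<inter> carrier G)" "infinite (carrier G - Y)"
    "\<And>h. h \<in> carrier G \<Longrightarrow> h \<otimes> eval G w \<in> Y \<longleftrightarrow> h \<in> Y"
    using free_on.basis_almost_invariant[OF B b(1) b(2)[symmetric]] by metis
  show thesis
    using no_full_turns[OF assms(1-4) Y(1-3) w(1,2) Y(4)] that by blast
qed

end

section \<open>Counting subwords\<close>

text \<open>For nonempty \<open>v\<close>, this counts the possibly overlapping occurrences of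
  \<open>v\<close> as a contiguous subword, by their starting positions.\<close>

fun count_prefixes :: "'a list \<Rightarrow> 'a list \<Rightarrow> nat" where
  "count_prefixes v [] = 0"
| "count_prefixes v (x # u) = of_bool (prefix v (x # u)) + count_prefixes v u"

lemma count_prefixes_append_ge:
  "count_prefixes v a + count_prefixes v b \<le> count_prefixes v (a @ b)"
proof (induction a)
  case (Cons x a)
  have "prefix v (x # a) \<Longrightarrow> prefix v (x # a @ b)"
    using prefix_prefix[of v "x # a" b] by simp
  then show ?case
    using Cons by auto
qed simp

text \<open>Only an occurrence that starts in \<open>a\<close> and runs into \<open>b\<close> is
  new, and its start is near the end of \<open>a\<close>. The minimum makes the induction work: it
  grows exactly when \<open>x # a\<close> is too short to contain \<open>v\<close>.\<close>

lemma count_prefixes_append_le_min: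
  "count_prefixes v (a @ b) \<le> count_prefixes v a + count_prefixes v b + min (length a) (length v)"
proof (induction a)
  case (Cons x a)
  show ?case
  proof (cases "length v \<le> length (x # a)")
    case True
    then have "prefix v (x # a @ b) \<longleftrightarrow> prefix v (x # a)"
      using prefix_length_prefix[of v "x # a @ b" "x # a"] prefix_prefix[of v "x # a" b] by auto
    moreover have "min (length a) (length v) \<le> min (length (x # a)) (length v)"
      by simp
    ultimately show ?thesis
      using Cons by simp
  next
    case False
    then have "min (length (x # a)) (length v) = Suc (min (length a) (length v))"
      by simp
    then show ?thesis
      using Cons by simp
  qed
qed simp

lemma count_prefixes_append_le:
  "count_prefixes v (a @ b) \<le> count_prefixes v a + count_prefixes v b + length v"
  using count_prefixes_append_le_min[of v a b] by linarith

lemma count_prefixes_pos: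
  "count_prefixes v u \<noteq> 0 \<Longrightarrow> \<exists>p q. u = p @ v @ q"
proof (induction u)
  case (Cons x u)
  show ?case
  proof (cases "prefix v (x # u)")
    case True
    then show ?thesis
      by (metis prefixE append_Nil)
  next
    case False
    then obtain p q where "u = p @ v @ q"
      using Cons by auto
    then show ?thesis
      by (intro exI[of _ "x # p"] exI[of _ q]) simp
  qed
qed simp

lemma count_prefixes_power:
  assumes "v \<noteq> []"
  shows "m \<le> count_prefixes v (concat (replicate m v))"
proof (induction m)
  case (Suc m)
  have "count_prefixes v v \<ge> 1"
    using assms by (cases v) auto
  then show ?case
    using Suc count_prefixes_append_ge[of v v "concat (replicate m v)"] by simp
qed simp

text \<open>The second count equals that of \<open>winv v\<close> in \<open>u\<close>; inverting
  \<open>u\<close> instead makes antisymmetry immediate.\<close>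

definition brooks :: "('a \<times> bool) list \<Rightarrow> ('a \<times> bool) list \<Rightarrow> int" where
  "brooks v u = int (count_prefixes v u) - int (count_prefixes v (winv u))"

lemma brooks_winv: "brooks v (winv u) = - brooks v u"
  by (simp add: brooks_def)

lemma brooks_append:
  "brooks v (a @ b) \<le> brooks v a + brooks v b + int (length v)"
  "brooks v a + brooks v b \<le> brooks v (a @ b) + int (length v)"
  using count_prefixes_append_le[of v a b] count_prefixes_append_ge[of v a b]
    count_prefixes_append_le[of v "winv b" "winv a"] count_prefixes_append_ge[of v "winv b" "winv a"]
  by (simp_all add: brooks_def)

text \<open>The inverse of a positive word has only negative letters, so the subtracted count
  vanishes.\<close>

lemma brooks_positive_power:
  assumes "v \<noteq> []" "\<And>l. l \<in> set v \<Longrightarrow> snd l"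
  shows "int m \<le> brooks v (concat (replicate m v))"
proof -
  have "count_prefixes v (winv (concat (replicate m v))) = 0"
  proof (rule ccontr)
    assume "count_prefixes v (winv (concat (replicate m v))) \<noteq> 0"
    then obtain p q where "winv (concat (replicate m v)) = p @ v @ q"
      using count_prefixes_pos by blast
    then have "hd v \<in> set (winv (concat (replicate m v)))"
      using assms(1) by simp
    then have "\<not> snd (hd v)"
      using assms(2) by (auto simp: winv_def)
    then show False
      using assms by simp
  qed
  then show ?thesis
    using count_prefixes_power[OF assms(1), of m] by (simp add: brooks_def)
qed

section \<open>Finite rank at least two and the conclusion\<close>

lemma (in free_on) primitive_width_finite_rank:
  assumes "finite X" "x \<in> X" "y \<in> X" "x \<noteq> y"
  shows "primitive_width G = \<infinity>"
  unfolding primitive_width_def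
proof -
  obtain xs where xs: "set xs = X"
    using finite_list[OF assms(1)] by blast
  define v where "v = concat (map (\<lambda>(a, b). [(a, True), (b, True)]) (List.product xs xs))"
  have v_pos: "snd l" "fst l \<in> X" if "l \<in> set v" for l
    using that xs by (auto simp: v_def)
  have v_pairs: "\<exists>p q. v = p @ (a, True) # (b, True) # q" if "a \<in> X" "b \<in> X" for a b
  proof -
    have "(a, b) \<in> set (List.product xs xs)"
      using that xs by simp
    then obtain ps qs where "List.product xs xs = ps @ (a, b) # qs"
      by (meson split_list)
    then show ?thesis
      by (auto simp: v_def)
  qed
  then have "v \<noteq> []"
    using assms(2) by fastforce
  let ?f = "\<lambda>g. brooks v (nf g)"
  show "width G {g. primitive G g} = \<infinity>"
  \<comment> \<open>Each junction costs \<open>length v\<close>: two in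
    \<open>t @ w @ winv t\<close>, and three in comparing \<open>a @ b\<close> with
    \<open>a @ c\<close> and \<open>winv c @ b\<close>. The terms of \<open>t\<close> and of
    \<open>c\<close> cancel by antisymmetry.\<close>
  proof (rule width_infinite[where f = ?f and C = "2 * int (length v)" and D = "3 * int (length v)"])
    show "?f (g \<otimes> h) \<le> ?f g + ?f h + 3 * int (length v)"
      if gh: "g \<in> carrier G" "h \<in> carrier G" for g h
    proof -
      obtain a b c where "nf g = a @ c" "nf h = winv c @ b" "nf (g \<otimes> h) = a @ b"
        using nf_mult[OF gh] .
      then show ?thesis
        using brooks_append(1)[of v a b] brooks_append(2)[of v a c] brooks_append(2)[of v "winv c" b]
        by (simp add: brooks_winv)
    qed
    show "\<exists>g\<in>carrier G. int m \<le> ?f g" for m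
    proof
      let ?w = "concat (replicate m v)"
      have "reduced ?w" "fst ` set ?w \<subseteq> X"
        using v_pos by (auto intro!: reduced_if_all_positive)
      then show "eval G ?w \<in> carrier G" "int m \<le> ?f (eval G ?w)"
        using brooks_positive_power[OF \<open>v \<noteq> []\<close> v_pos(1)] by (simp_all add: nf_eval)
    qed
    show "?f g \<le> 2 * int (length v)" if "g \<in> {g. primitive G g}" for g
    proof (cases "g = \<one>")
      case True
      then show ?thesis by (simp add: brooks_def)
    next
      case False
      have prim: "primitive G g" and gc: "g \<in> carrier G"
        using that primitive_carrier by auto
      obtain t w where tw: "nf g = t @ w @ winv t" "w \<noteq> []" "reduced (w @ w)"
        using reduced_cyclic_decomp[OF nf_reduced[OF gc]] False gc nf_eq_Nil by metis
      have X: "fst ` set t \<subseteq> X" "fst ` set w \<subseteq> X"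
        using nf_letters[OF gc] tw(1) by (auto simp: image_Un)
      have "g = eval G t \<otimes> (eval G w \<otimes> inv (eval G t))"
        using eval_nf[OF gc] X unfolding tw(1) by (simp add: eval_app eval_inv image_Un)
      then have "inv (eval G t) \<otimes> g \<otimes> eval G t = eval G w"
        using X by (simp add: m_assoc) (simp flip: m_assoc)
      then have "primitive G (eval G w)"
        using primitive_conjugate[OF prim, of "eval G t"] X by simp
      then obtain a b where ab: "a \<in> X" "b \<in> X" "\<And>p q. w \<noteq> p @ (a, True) # (b, True) # q"
        using primitive_not_full_turns[OF assms X(2) tw(3)] by metis
      have "count_prefixes v w = 0"
      proof (rule ccontr)
        assume "count_prefixes v w \<noteq> 0"
        then obtain p q where "w = p @ v @ q"
          using count_prefixes_pos by blast
        moreover obtain p' q' where "v = p' @ (a, True) # (b, True) # q'"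
          using v_pairs ab by blast
        ultimately have "w = (p @ p') @ (a, True) # (b, True) # (q' @ q)"
          by simp
        then show False
          using ab(3) by blast
      qed
      \<comment> \<open>Occurrences of \<open>winv v\<close> in \<open>w\<close> only lower the
        value, so an upper bound needs no control of them.\<close>
      then have "brooks v w \<le> 0"
        by (simp add: brooks_def)
      then show ?thesis
        using brooks_append(1)[of v t "w @ winv t"] brooks_append(1)[of v w "winv t"] tw(1)
        by (simp add: brooks_winv)
    qed
  qed (auto intro: primitive_carrier)
qed

text \<open>The trivial group is excluded: it is finitely generated, but it has no primitive
  elements and its only element is the empty product, so its width is zero.\<close>

theorem theorem2p1:
  fixes F :: "('a, 'b) monoid_scheme"
  assumes "free_group F" and "carrier F \<noteq> {\<one>\<^bsub>F\<^esub>}"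
  shows "(primitive_width F = \<infinity> \<longleftrightarrow> finitely_generated F) \<and>
         (\<not> finitely_generated F \<longrightarrow> primitive_width F = 2)"
proof -
  obtain X where "group F" and X: "free_basis F X"
    using assms(1) by (auto simp: free_group_def)
  then interpret free_on F X
    by (simp add: free_on_def free_on_axioms_def)
  have "X \<noteq> {}"
    using X assms(2) generate_empty by (auto simp: free_basis_def)
  have "primitive_width F = \<infinity>" if "finitely_generated F"
  proof (cases "\<exists>x y. x \<in> X \<and> y \<in> X \<and> x \<noteq> y")
    case True
    then show ?thesis
      using primitive_width_finite_rank finite_basis[OF that] by blast
  next
    case False
    then obtain x where "X = {x}"
      using \<open>X \<noteq> {}\<close> by blast
    then show ?thesis
      by (rule primitive_width_cyclic)
  qed
  moreover have "primitive_width F = 2" if "\<not> finitely_generated F"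
  proof -
    have "infinite X"
      using that X by (auto simp: finitely_generated_def free_basis_def)
    then show ?thesis
      by (rule primitive_width_infinite_rank)
  qed
  \<comment> \<open>The converse of the equivalence holds because 2 differs from
    \<open>\<infinity>\<close>.\<close>
  ultimately show ?thesis
    by fastforce
qed

end
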